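(* A $(DF)$-space $E$ is normable if and only if $E$ has countable fan tightness.
   Context: A locally convex space $E$ is a $(DF)$-space if $E$ has a fundamental sequence of bounded sets and every bounded set in the strong dual $(E',\beta(E',E))$ of $E$ which is a countable union of equicontinuous sets is itself equicontinuous. A topological space $X$ has countable fan tightness if for each $x\in X$ and all sets $A_n\subset X$, $n\in\mathbb{N}$, with $x\in\bigcap_{n\in\mathbb{N}}\overline{A_n}$ there are finite sets $F_n\subset A_n$, $n\in\mathbb{N}$, such that $x\in\overline{\bigcup_{n\in\mathbb{N}}F_n}$. *)

theory Defs
  imports "HOL-Analysis.Analysis" "HOL-Library.Function_Algebras"
begin

text \<open>
  The scalar multiplication \<open>scl\<close> is an explicit parameter so that the same definitions serve
  real vector spaces, complex vector spaces, and spaces of scalar-valued functions.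
  Topologies are abstract topologies, and a locally convex space is Hausdorff by convention.
\<close>

definition locally_convex_space ::
  "('k::real_normed_field \<Rightarrow> 'a::ab_group_add \<Rightarrow> 'a) \<Rightarrow> 'a topology \<Rightarrow> bool" where
  "locally_convex_space scl X \<longleftrightarrow>
     vector_space scl \<and> topspace X = UNIV \<and> Hausdorff_space X \<and>
     continuous_map (prod_topology X X) X (\<lambda>(x, y). x + y) \<and>
     continuous_map (prod_topology euclidean X) X (\<lambda>(c, x). scl c x) \<and>
     (\<forall>U. openin X U \<and> 0 \<in> U \<longrightarrow>
        (\<exists>V C. openin X V \<and> 0 \<in> V \<and> V \<subseteq> C \<and> C \<subseteq> U \<and>
           (\<forall>x\<in>C. \<forall>y\<in>C. \<forall>t\<in>{0..1}. scl (of_real t) x + scl (of_real (1 - t)) y \<in> C)))"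

text \<open>Boundedness in the sense of von Neumann: absorption by every neighbourhood of zero.\<close>

definition tvs_bounded ::
  "('k::real_normed_field \<Rightarrow> 'a::ab_group_add \<Rightarrow> 'a) \<Rightarrow> 'a topology \<Rightarrow> 'a set \<Rightarrow> bool" where
  "tvs_bounded scl X B \<longleftrightarrow>
     B \<subseteq> topspace X \<and>
     (\<forall>U. openin X U \<and> 0 \<in> U \<longrightarrow> (\<exists>r>0. \<forall>c. r \<le> norm c \<longrightarrow> B \<subseteq> scl c ` U))"

definition continuous_dual ::
  "('k::real_normed_field \<Rightarrow> 'a::ab_group_add \<Rightarrow> 'a) \<Rightarrow> 'a topology \<Rightarrow> ('a \<Rightarrow> 'k) set" where
  "continuous_dual scl X = {f. Vector_Spaces.linear scl (*) f \<and> continuous_map X euclidean f}"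

definition dual_scale :: "'k::times \<Rightarrow> ('a \<Rightarrow> 'k) \<Rightarrow> 'a \<Rightarrow> 'k" where
  "dual_scale c f = (\<lambda>x. c * f x)"

text \<open>
  The strong topology \<open>\<beta>(E', E)\<close> of uniform convergence on the bounded subsets of \<open>E\<close>; its
  underlying set is the continuous dual, a proper subset of the function type.
  The sets in the neighbourhood condition are neighbourhoods of \<open>f\<close> and need not be open.
\<close>

definition strong_topology ::
  "('k::real_normed_field \<Rightarrow> 'a::ab_group_add \<Rightarrow> 'a) \<Rightarrow> 'a topology \<Rightarrow> ('a \<Rightarrow> 'k) topology" where
  "strong_topology scl X = topology (\<lambda>W. W \<subseteq> continuous_dual scl X \<and>
     (\<forall>f\<in>W. \<exists>B e. tvs_bounded scl X B \<and> 0 < e \<and>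
        {g \<in> continuous_dual scl X. \<forall>x\<in>B. norm (g x - f x) \<le> e} \<subseteq> W))"

definition equicontinuous_set :: "'a topology \<Rightarrow> ('a \<Rightarrow> 'k::metric_space) set \<Rightarrow> bool" where
  "equicontinuous_set X H \<longleftrightarrow>
     (\<forall>x\<in>topspace X. \<forall>e>0. \<exists>U. openin X U \<and> x \<in> U \<and> (\<forall>f\<in>H. \<forall>y\<in>U. dist (f y) (f x) < e))"

definition has_fundamental_sequence_of_bounded_sets ::
  "('k::real_normed_field \<Rightarrow> 'a::ab_group_add \<Rightarrow> 'a) \<Rightarrow> 'a topology \<Rightarrow> bool" where
  "has_fundamental_sequence_of_bounded_sets scl X \<longleftrightarrow>
     (\<exists>B :: nat \<Rightarrow> 'a set. (\<forall>n. tvs_bounded scl X (B n)) \<and>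
        (\<forall>C. tvs_bounded scl X C \<longrightarrow> (\<exists>n. C \<subseteq> B n)))"

definition DF_space ::
  "('k::real_normed_field \<Rightarrow> 'a::ab_group_add \<Rightarrow> 'a) \<Rightarrow> 'a topology \<Rightarrow> bool" where
  "DF_space scl X \<longleftrightarrow>
     locally_convex_space scl X \<and>
     has_fundamental_sequence_of_bounded_sets scl X \<and>
     (\<forall>M. tvs_bounded dual_scale (strong_topology scl X) M \<and>
          (\<exists>H :: nat \<Rightarrow> ('a \<Rightarrow> 'k) set.
             (\<forall>n. H n \<subseteq> continuous_dual scl X \<and> equicontinuous_set X (H n)) \<and> M = (\<Union>n. H n))
        \<longrightarrow> equicontinuous_set X M)"

definition normable ::
  "('k::real_normed_field \<Rightarrow> 'a::ab_group_add \<Rightarrow> 'a) \<Rightarrow> 'a topology \<Rightarrow> bool" where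
  "normable scl X \<longleftrightarrow>
     (\<exists>p :: 'a \<Rightarrow> real.
        (\<forall>x. 0 \<le> p x) \<and> (\<forall>x. p x = 0 \<longleftrightarrow> x = 0) \<and>
        (\<forall>c x. p (scl c x) = norm c * p x) \<and>
        (\<forall>x y. p (x + y) \<le> p x + p y) \<and>
        X = Metric_space.mtopology UNIV (\<lambda>x y. p (x - y)))"

definition countable_fan_tightness :: "'a topology \<Rightarrow> bool" where
  "countable_fan_tightness X \<longleftrightarrow>
     (\<forall>x\<in>topspace X. \<forall>A :: nat \<Rightarrow> 'a set.
        (\<forall>n. A n \<subseteq> topspace X) \<and> x \<in> (\<Inter>n. X closure_of A n) \<longrightarrow>
        (\<exists>F. (\<forall>n. finite (F n) \<and> F n \<subseteq> A n) \<and> x \<in> X closure_of (\<Union>n. F n)))"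

lemma tvs_bounded_Un:
  assumes "tvs_bounded scl X A" and "tvs_bounded scl X B"
  shows "tvs_bounded scl X (A \<union> B)"
  unfolding tvs_bounded_def
proof (intro conjI allI impI)
  show "A \<union> B \<subseteq> topspace X" using assms unfolding tvs_bounded_def by blast
next
  fix U assume U: "openin X U \<and> 0 \<in> U"
  obtain r s where "0 < r" "0 < s"
    and "\<forall>c. r \<le> norm c \<longrightarrow> A \<subseteq> scl c ` U" "\<forall>c. s \<le> norm c \<longrightarrow> B \<subseteq> scl c ` U"
    using assms U unfolding tvs_bounded_def by meson
  then show "\<exists>r>0. \<forall>c. r \<le> norm c \<longrightarrow> A \<union> B \<subseteq> scl c ` U"
    by (intro exI[of _ "max r s"]) auto
qed

lemma openin_strong_topology:
  "openin (strong_topology scl X) W \<longleftrightarrow> W \<subseteq> continuous_dual scl X \<and>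
     (\<forall>f\<in>W. \<exists>B e. tvs_bounded scl X B \<and> 0 < e \<and>
        {g \<in> continuous_dual scl X. \<forall>x\<in>B. norm (g x - f x) \<le> e} \<subseteq> W)"
proof -
  let ?N = "\<lambda>f B e. {g \<in> continuous_dual scl X. \<forall>x\<in>B. norm (g x - f x) \<le> e}"
  let ?P = "\<lambda>W. W \<subseteq> continuous_dual scl X \<and>
     (\<forall>f\<in>W. \<exists>B e. tvs_bounded scl X B \<and> 0 < e \<and> ?N f B e \<subseteq> W)"
  have "?P (S \<inter> T)" if S: "?P S" and T: "?P T" for S T
  proof (intro conjI ballI)
    show "S \<inter> T \<subseteq> continuous_dual scl X" using S by blast
  next
    fix f assume "f \<in> S \<inter> T"
    then obtain A a B b where A: "tvs_bounded scl X A" "0 < a" "?N f A a \<subseteq> S"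
      and B: "tvs_bounded scl X B" "0 < b" "?N f B b \<subseteq> T"
      using S T by (meson IntD1 IntD2)
    have "?N f (A \<union> B) (min a b) \<subseteq> ?N f A a \<inter> ?N f B b" by auto
    then have "?N f (A \<union> B) (min a b) \<subseteq> S \<inter> T" using A B by blast
    with A B show "\<exists>B e. tvs_bounded scl X B \<and> 0 < e \<and> ?N f B e \<subseteq> S \<inter> T"
      by (intro exI[of _ "A \<union> B"] exI[of _ "min a b"]) (simp add: tvs_bounded_Un)
  qed
  moreover have "?P (\<Union>K)" if K: "\<forall>S\<in>K. ?P S" for K
  proof (intro conjI ballI)
    show "\<Union>K \<subseteq> continuous_dual scl X" using K by blast
  next
    fix f assume "f \<in> \<Union>K"
    then obtain S where "S \<in> K" "f \<in> S" by blast
    then obtain B e where "tvs_bounded scl X B" "0 < e" "?N f B e \<subseteq> S" using K by meson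
    then show "\<exists>B e. tvs_bounded scl X B \<and> 0 < e \<and> ?N f B e \<subseteq> \<Union>K"
      using \<open>S \<in> K\<close> by blast
  qed
  ultimately have "istopology ?P" unfolding istopology_def by blast
  then show ?thesis unfolding strong_topology_def by (simp add: topology_inverse')
qed

lemma topspace_strong_topology:
  "topspace (strong_topology scl X) = continuous_dual scl X"
proof
  show "topspace (strong_topology scl X) \<subseteq> continuous_dual scl X"
    using openin_strong_topology[of scl X] by (meson openin_topspace)
  have "tvs_bounded scl X {}" by (auto simp: tvs_bounded_def intro: exI[of _ 1])
  then have "openin (strong_topology scl X) (continuous_dual scl X)"
    unfolding openin_strong_topology by (auto intro!: exI[of _ "{}"] exI[of _ 1])
  then show "continuous_dual scl X \<subseteq> topspace (strong_topology scl X)"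
    by (rule openin_subset)
qed

end

theory Submission
  imports Defs
begin

text \<open>
  A normable space is metrizable, and a metrizable space has countable fan tightness: one point
  of each set, chosen ever closer to the limit point, is enough.

  For the converse let \<open>B 0 \<subseteq> B 1 \<subseteq> \<dots>\<close> be a fundamental sequence of bounded sets of the
  (DF)-space. Call a point detected at stage \<open>n\<close> if some continuous functional that is bounded by
  one on \<open>B n\<close> has modulus at least one at that point. There are two possibilities.

  If for some \<open>n\<close> zero is not in the closure of the points detected at stage \<open>n\<close>, then a
  neighbourhood \<open>U\<close> of zero contains no such point. It lies in the bipolar of \<open>B n\<close>, and by the
  Hahn-Banach theorem \<open>U\<close> is bounded (\<open>bounded_if_disjoint_polar_detected\<close>). A Hausdorff locally
  convex space with a bounded neighbourhood of zero is normable (\<open>normable_if_bounded_nhd\<close>).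

  If zero is in the closure of the points detected at stage \<open>n\<close> for every \<open>n\<close>, then countable fan
  tightness selects finitely many of them at each stage such that zero is in the closure of the
  selected points. The functionals that detect them form a strongly bounded countable set, so
  they are equicontinuous by the (DF) property. This is absurd: near zero they would all have
  modulus less than one, yet selected points occur there
  (\<open>DF_space_fan_tight_some_not_closure\<close>).

  The Hahn-Banach theorem is used only through norming functionals for seminorms. It is derived
  from the fact that minimal sublinear functions are linear, and the complex case from the real
  one.
\<close>

section \<open>Linear functionals below a sublinear function\<close>

definition sublinear :: "(real \<Rightarrow> 'a::ab_group_add \<Rightarrow> 'a) \<Rightarrow> ('a \<Rightarrow> real) \<Rightarrow> bool" where
  "sublinear R q \<longleftrightarrow>
     (\<forall>x y. q (x + y) \<le> q x + q y) \<and> (\<forall>t x. 0 < t \<longrightarrow> q (R t x) \<le> t * q x)"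

lemma sublinear_scale:
  assumes "vector_space R" "sublinear R q" "0 < t"
  shows "q (R t x) = t * q x"
proof (rule antisym)
  interpret vector_space R by fact
  show "q (R t x) \<le> t * q x" using assms unfolding sublinear_def by blast
  have "q (R (1/t) (R t x)) \<le> (1/t) * q (R t x)"
    using assms unfolding sublinear_def by (meson zero_less_divide_1_iff)
  then show "t * q x \<le> q (R t x)" using \<open>0 < t\<close> by (simp add: field_simps)
qed

lemma sublinear_zero:
  assumes "vector_space R" "sublinear R q"
  shows "q 0 = 0"
proof -
  interpret vector_space R by fact
  show ?thesis using sublinear_scale[OF assms, of 2 0] by simp
qed

lemma sublinear_neg_ge:
  assumes "vector_space R" "sublinear R q"
  shows "- q (- x) \<le> q x"
proof -
  have "q (x + - x) \<le> q x + q (- x)" using assms(2) unfolding sublinear_def by blast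
  then show ?thesis using sublinear_zero[OF assms] by simp
qed

text \<open>
  This is the largest sublinear function \<open>r \<le> q\<close> with \<open>r (- y) \<le> - q y\<close>. It has two uses below:
  a minimal sublinear function equals its own lowering along every \<open>y\<close>, which forces it to be
  odd, and lowering the majorant along \<open>z\<close> forces every linear functional below the result to
  attain the majorant at \<open>z\<close>.
\<close>
definition lowered_along ::
  "(real \<Rightarrow> 'a::ab_group_add \<Rightarrow> 'a) \<Rightarrow> ('a \<Rightarrow> real) \<Rightarrow> 'a \<Rightarrow> 'a \<Rightarrow> real" where
  "lowered_along R q y x = (INF t\<in>{0..}. q (x + R t y) - t * q y)"

lemma lowered_along:
  assumes V: "vector_space R" and q: "sublinear R q"
  shows sublinear_lowered_along: "sublinear R (lowered_along R q y)"
    and lowered_along_le: "lowered_along R q y x \<le> q x"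
    and lowered_along_uminus: "lowered_along R q y (- y) \<le> - q y"
proof -
  interpret vector_space R by fact
  let ?L = "lowered_along R q y"
  have sub: "q (x + y) \<le> q x + q y" for x y using q unfolding sublinear_def by blast
  have bound: "- q (- x) \<le> q (x + R t y) - t * q y" if "0 \<le> t" for t x
  proof -
    have "t * q y = q (R t y)"
      using sublinear_scale[OF V q, of t y] sublinear_zero[OF V q] that
      by (cases "t = 0") auto
    also have "\<dots> \<le> q (x + R t y) + q (- x)" using sub[of "x + R t y" "- x"] by simp
    finally show ?thesis by simp
  qed
  have bdd: "bdd_below ((\<lambda>t. q (x + R t y) - t * q y) ` {0..})" for x
    using bound by (intro bdd_belowI2[where m = "- q (- x)"]) auto
  have le: "?L x \<le> q (x + R t y) - t * q y" if "0 \<le> t" for t x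
    unfolding lowered_along_def using that by (intro cINF_lower bdd) auto
  have ge: "m \<le> ?L x" if "\<And>t. 0 \<le> t \<Longrightarrow> m \<le> q (x + R t y) - t * q y" for m x
    unfolding lowered_along_def using that by (intro cINF_greatest) auto
  show "?L x \<le> q x" using le[of 0 x] by simp
  show "?L (- y) \<le> - q y" using le[of 1 "- y"] sublinear_zero[OF V q] by simp
  show "sublinear R ?L"
    unfolding sublinear_def
  proof (intro conjI allI impI)
    fix u v
    have "?L (u + v) - (q (u + R s y) - s * q y) \<le> ?L v" if "0 \<le> s" for s
    proof (rule ge)
      fix t :: real assume "0 \<le> t"
      have "?L (u + v) \<le> q (u + v + R (s + t) y) - (s + t) * q y"
        using \<open>0 \<le> s\<close> \<open>0 \<le> t\<close> by (intro le) simp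
      also have "u + v + R (s + t) y = (u + R s y) + (v + R t y)"
        by (simp add: scale_left_distrib)
      finally show "?L (u + v) - (q (u + R s y) - s * q y) \<le> q (v + R t y) - t * q y"
        using sub[of "u + R s y" "v + R t y"] by (simp add: algebra_simps)
    qed
    then have "?L (u + v) - ?L v \<le> ?L u" by (intro ge) (simp add: algebra_simps)
    then show "?L (u + v) \<le> ?L u + ?L v" by simp
  next
    fix a :: real and u assume a: "0 < a"
    have "(1/a) * ?L (R a u) \<le> ?L u"
    proof (rule ge)
      fix t :: real assume "0 \<le> t"
      have "?L (R a u) \<le> q (R a u + R (a * t) y) - (a * t) * q y"
        using a \<open>0 \<le> t\<close> by (intro le) simp
      also have "R a u + R (a * t) y = R a (u + R t y)" by (simp add: scale_right_distrib)
      also have "q \<dots> = a * q (u + R t y)" by (rule sublinear_scale[OF V q a])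
      finally show "(1/a) * ?L (R a u) \<le> q (u + R t y) - t * q y"
        using a by (simp add: field_simps)
    qed
    then show "?L (R a u) \<le> a * ?L u" using a by (simp add: field_simps)
  qed
qed

text \<open>
  Finiteness of the pointwise infimum comes from the common lower bound \<open>x \<mapsto> - p (- x)\<close>.
  Subadditivity needs the chain: two members are compared at once with the smaller of them.
\<close>
lemma sublinear_INF_chain:
  assumes V: "vector_space R" and "C \<noteq> {}" and C: "\<forall>q\<in>C. sublinear R q \<and> q \<le> p"
    and chain: "\<forall>q\<in>C. \<forall>r\<in>C. q \<le> r \<or> r \<le> q"
  shows "sublinear R (\<lambda>x. INF q\<in>C. q x)" and "\<forall>q\<in>C. \<forall>x. (INF q\<in>C. q x) \<le> q x"
proof -
  let ?u = "\<lambda>x. INF q\<in>C. q x"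
  have "- p (- x) \<le> q x" if "q \<in> C" for q x
  proof -
    have "- q (- x) \<le> q x" "q (- x) \<le> p (- x)"
      using sublinear_neg_ge[OF V, of q x] C that by (auto simp: le_fun_def)
    then show ?thesis by linarith
  qed
  then have bdd: "bdd_below ((\<lambda>q. q x) ` C)" for x by (intro bdd_belowI2)
  have le: "?u x \<le> q x" if "q \<in> C" for q x by (intro cINF_lower bdd that)
  then show "\<forall>q\<in>C. \<forall>x. ?u x \<le> q x" by blast
  have ge: "m \<le> ?u x" if "\<And>q. q \<in> C \<Longrightarrow> m \<le> q x" for m x
    using that \<open>C \<noteq> {}\<close> by (intro cINF_greatest)
  show "sublinear R ?u"
    unfolding sublinear_def
  proof (intro conjI allI impI)
    fix x y
    have key: "?u (x + y) \<le> q x + r y" if qr: "q \<in> C" "r \<in> C" for q r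
    proof -
      obtain s where s: "s \<in> C" "s \<le> q" "s \<le> r" using chain qr by (metis order_refl)
      have "?u (x + y) \<le> s (x + y)" by (rule le[OF s(1)])
      also have "\<dots> \<le> s x + s y" using C s(1) unfolding sublinear_def by blast
      also have "\<dots> \<le> q x + r y" using s by (intro add_mono) (auto simp: le_fun_def)
      finally show ?thesis .
    qed
    have "?u (x + y) - q x \<le> ?u y" if "q \<in> C" for q
      using key[OF that] by (intro ge) (simp add: algebra_simps)
    then have "?u (x + y) - ?u y \<le> ?u x" by (intro ge) (simp add: algebra_simps)
    then show "?u (x + y) \<le> ?u x + ?u y" by simp
  next
    fix t :: real and x assume t: "0 < t"
    have "(1/t) * ?u (R t x) \<le> ?u x"
    proof (rule ge)
      fix q assume q: "q \<in> C"
      have "?u (R t x) \<le> t * q x"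
        using le[OF q, of "R t x"] sublinear_scale[OF V _ t, of q x] C q by simp
      then show "(1/t) * ?u (R t x) \<le> q x" using t by (simp add: field_simps)
    qed
    then show "?u (R t x) \<le> t * ?u x" using t by (simp add: field_simps)
  qed
qed

lemma exists_minimal_sublinear:
  assumes V: "vector_space R" and p: "sublinear R p"
  shows "\<exists>m. sublinear R m \<and> m \<le> p \<and> (\<forall>q. sublinear R q \<and> q \<le> m \<longrightarrow> q = m)"
proof -
  let ?A = "{q. sublinear R q \<and> q \<le> p}"
  let ?P = "\<lambda>f g :: 'a \<Rightarrow> real. g \<le> f"
  have "\<exists>m\<in>?A. \<forall>a\<in>?A. ?P m a \<longrightarrow> a = m"
  proof (rule predicate_Zorn)
    show "partial_order_on ?A (relation_of ?P ?A)"
      by (rule partial_order_on_relation_ofI) auto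
  next
    fix C assume ch: "C \<in> Chains (relation_of ?P ?A)"
    have C: "\<forall>q\<in>C. sublinear R q \<and> q \<le> p"
      using ch unfolding Chains_def relation_of_def by auto
    have chain: "\<forall>q\<in>C. \<forall>r\<in>C. q \<le> r \<or> r \<le> q"
      using ch unfolding Chains_def relation_of_def by auto
    show "\<exists>u\<in>?A. \<forall>a\<in>C. ?P a u"
    proof (cases "C = {}")
      case True then show ?thesis using p by auto
    next
      case False
      note u = sublinear_INF_chain[OF V False C chain]
      obtain q where q: "q \<in> C" using False by blast
      have "(\<lambda>x. INF q\<in>C. q x) \<le> p"
        using u(2) C q by (auto simp: le_fun_def intro: order_trans)
      then show ?thesis using u
        by (intro bexI[of _ "\<lambda>x. INF q\<in>C. q x"]) (auto simp: le_fun_def)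
    qed
  qed
  then show ?thesis by (auto intro: order_trans)
qed

text \<open>
  Lowering along \<open>y\<close> cannot change a minimal \<open>m\<close>, so \<open>m (- y) = - m y\<close>. Subadditivity at
  \<open>- x\<close> and \<open>- y\<close> then gives the reverse inequality at \<open>x\<close> and \<open>y\<close>.
\<close>
lemma minimal_sublinear_linear:
  assumes V: "vector_space R" and m: "sublinear R m"
    and min: "\<And>q. sublinear R q \<Longrightarrow> q \<le> m \<Longrightarrow> q = m"
  shows "m (x + y) = m x + m y" and "m (R t x) = t * m x"
proof -
  interpret vector_space R by fact
  have "lowered_along R m y = m" for y
    using sublinear_lowered_along[OF V m] lowered_along_le[OF V m]
    by (intro min) (auto simp: le_fun_def)
  then have "m (- y) \<le> - m y" for y using lowered_along_uminus[OF V m, of y] by simp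
  then have neg: "m (- y) = - m y" for y
    using sublinear_neg_ge[OF V m, of y] by (smt (verit))
  have sub: "m (x + y) \<le> m x + m y" for x y using m unfolding sublinear_def by blast
  show "m (x + y) = m x + m y"
    using sub[of x y] sub[of "- x" "- y"] neg[of "x + y"] neg by simp
  consider "t = 0" | "0 < t" | "0 < - t" by linarith
  then show "m (R t x) = t * m x"
  proof cases
    case 1 then show ?thesis using sublinear_zero[OF V m] by simp
  next
    case 2 then show ?thesis by (rule sublinear_scale[OF V m])
  next
    case 3 then show ?thesis
      using sublinear_scale[OF V m 3, of x] neg[of "R t x"] by simp
  qed
qed

text \<open>
  The Hahn-Banach theorem without subspaces and extensions: below the majorant, lowered along
  \<open>z\<close>, lies a minimal sublinear function by Zorn's lemma, and minimal sublinear functions are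
  linear.
\<close>
lemma hahn_banach_sublinear:
  assumes V: "vector_space R" and p: "sublinear R p"
  obtains f where "\<And>x y. f (x + y) = f x + f y" "\<And>t x. f (R t x) = t * f x"
    "\<And>x. f x \<le> p x" "f z = p z"
proof -
  let ?L = "lowered_along R p z"
  obtain f where f: "sublinear R f" "f \<le> ?L"
      and min: "\<And>q. sublinear R q \<Longrightarrow> q \<le> f \<Longrightarrow> q = f"
    using exists_minimal_sublinear[OF V sublinear_lowered_along[OF V p]] by metis
  note lin = minimal_sublinear_linear[OF V f(1) min]
  have le: "f x \<le> p x" for x
    using f(2) lowered_along_le[OF V p] by (auto simp: le_fun_def intro: order_trans)
  have "f (- z) \<le> - p z"
    using f(2) lowered_along_uminus[OF V p] by (auto simp: le_fun_def intro: order_trans)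
  then have "p z \<le> f z" using sublinear_neg_ge[OF V f(1), of z] by simp
  then have "f z = p z" using le[of z] by simp
  with lin le show thesis by (rule that)
qed

section \<open>Norming functionals for seminorms\<close>

definition seminorm ::
  "('k::real_normed_field \<Rightarrow> 'a::ab_group_add \<Rightarrow> 'a) \<Rightarrow> ('a \<Rightarrow> real) \<Rightarrow> bool" where
  "seminorm scl p \<longleftrightarrow>
     (\<forall>x. 0 \<le> p x) \<and> (\<forall>x y. p (x + y) \<le> p x + p y) \<and> (\<forall>c x. p (scl c x) = norm c * p x)"

text \<open>
  The consequence of the Hahn-Banach theorem that the argument consumes. As a property of the
  scalar multiplication it isolates the only place where the real and the complex scalar field
  are treated separately.
\<close>
definition has_norming_functionals ::
  "('k::real_normed_field \<Rightarrow> 'a::ab_group_add \<Rightarrow> 'a) \<Rightarrow> bool" where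
  "has_norming_functionals scl \<longleftrightarrow>
     (\<forall>p z. seminorm scl p \<longrightarrow>
        (\<exists>f. Vector_Spaces.linear scl (*) f \<and> (\<forall>x. norm (f x) \<le> p x) \<and> norm (f z) = p z))"

lemma vector_space_field: "vector_space ((*) :: 'k::field \<Rightarrow> 'k \<Rightarrow> 'k)"
  by unfold_locales (auto simp: algebra_simps)

lemma has_norming_functionals_real:
  fixes scl :: "real \<Rightarrow> 'a::ab_group_add \<Rightarrow> 'a"
  assumes V: "vector_space scl"
  shows "has_norming_functionals scl"
  unfolding has_norming_functionals_def
proof (intro allI impI)
  interpret vector_space scl by fact
  fix p :: "'a \<Rightarrow> real" and z assume p: "seminorm scl p"
  then have "sublinear scl p" unfolding seminorm_def sublinear_def by auto
  then obtain f where f: "\<And>x y. f (x + y) = f x + f y" "\<And>t x. f (scl t x) = t * f x"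
    "\<And>x. f x \<le> p x" "f z = p z"
    using hahn_banach_sublinear[OF V, of p z] by metis
  have "\<bar>f x\<bar> \<le> p x" for x
  proof -
    have "p (scl (-1) x) = p x" using p unfolding seminorm_def by (metis norm_minus_cancel norm_one mult_1)
    then show ?thesis
      using f(3)[of x] f(3)[of "scl (-1) x"] f(2)[of "-1" x] by (auto simp: abs_le_iff)
  qed
  moreover have "Vector_Spaces.linear scl (*) f"
    unfolding Vector_Spaces.linear_iff using V vector_space_field f by auto
  ultimately show "\<exists>f. Vector_Spaces.linear scl (*) f \<and> (\<forall>x. norm (f x) \<le> p x) \<and> norm (f z) = p z"
    using f(4) p unfolding seminorm_def by (intro exI[of _ f]) auto
qed

text \<open>
  A complex linear functional is determined by its real part \<open>f\<close> through
  \<open>F x = f x - \<i> f (\<i> x)\<close>, so it suffices to find a real linear \<open>f\<close>.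
\<close>
lemma has_norming_functionals_complex:
  fixes scl :: "complex \<Rightarrow> 'a::ab_group_add \<Rightarrow> 'a"
  assumes V: "vector_space scl"
  shows "has_norming_functionals scl"
  unfolding has_norming_functionals_def
proof (intro allI impI)
  interpret vector_space scl by fact
  fix p :: "'a \<Rightarrow> real" and z assume p: "seminorm scl p"
  let ?R = "\<lambda>t::real. scl (of_real t)"
  have VR: "vector_space ?R"
    by unfold_locales (auto simp: scale_right_distrib scale_left_distrib)
  have "sublinear ?R p" using p unfolding seminorm_def sublinear_def by auto
  then obtain f where f: "\<And>x y. f (x + y) = f x + f y" "\<And>t x. f (?R t x) = t * f x"
    "\<And>x. f x \<le> p x" "f z = p z"
    using hahn_banach_sublinear[OF VR, of p z] by metis
  define F where "F x = Complex (f x) (- f (scl \<i> x))" for x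
  have smul: "f (scl c x) = Re c * f x + Im c * f (scl \<i> x)" for c x
  proof -
    have "scl c x = ?R (Re c) x + ?R (Im c) (scl \<i> x)"
      by (metis complex_eq mult.commute scale_left_distrib scale_scale)
    then have "f (scl c x) = f (?R (Re c) x) + f (?R (Im c) (scl \<i> x))" by (simp only: f(1))
    then show ?thesis by (simp only: f(2))
  qed
  have hom: "F (scl c x) = c * F x" for c x
  proof -
    have "f (scl \<i> (scl c x)) = - Im c * f x + Re c * f (scl \<i> x)"
      using smul[of "\<i> * c" x] by simp
    then show ?thesis unfolding F_def smul[of c x] by (simp add: complex_eq_iff algebra_simps)
  qed
  have "F (x + y) = F x + F y" for x y
    unfolding F_def by (simp add: complex_eq_iff scale_right_distrib f(1))
  then have lin: "Vector_Spaces.linear scl (*) F"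
    unfolding Vector_Spaces.linear_iff using V vector_space_field hom by auto
  have le: "norm (F x) \<le> p x" for x
  proof (cases "F x = 0")
    case True then show ?thesis using p unfolding seminorm_def by simp
  next
    case False
    \<comment> \<open>rotating \<open>x\<close> makes the value of \<open>F\<close> real, and there it agrees with \<open>f\<close>\<close>
    define c where "c = cnj (F x) / norm (F x)"
    have c: "norm c = 1" using False by (simp add: c_def norm_divide)
    have "c * F x = of_real (norm (F x))"
      using False by (simp add: c_def complex_norm_square[symmetric] power2_eq_square mult.commute)
    then have "norm (F x) = Re (F (scl c x))" unfolding hom by simp
    also have "\<dots> = f (scl c x)" by (simp add: F_def)
    also have "\<dots> \<le> p (scl c x)" by (rule f(3))
    also have "\<dots> = p x" using p c unfolding seminorm_def by simp
    finally show ?thesis .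
  qed
  have "p z \<le> norm (F z)" using f(4) abs_Re_le_cmod[of "F z"] by (simp add: F_def)
  with le[of z] have "norm (F z) = p z" by simp
  with lin le show "\<exists>f. Vector_Spaces.linear scl (*) f \<and> (\<forall>x. norm (f x) \<le> p x) \<and> norm (f z) = p z"
    by blast
qed

section \<open>Seminorms and boundedness in locally convex spaces\<close>

lemma seminorm_zero:
  assumes "vector_space scl" "seminorm scl p"
  shows "p 0 = 0"
proof -
  interpret vector_space scl by fact
  show ?thesis using assms(2) scale_zero_left[of 0] unfolding seminorm_def
    by (metis mult_zero_left norm_zero)
qed

lemma seminorm_uminus:
  assumes "vector_space scl" "seminorm scl p"
  shows "p (- x) = p x"
proof -
  interpret vector_space scl by fact
  have "p (scl (-1) x) = p x" using assms(2) unfolding seminorm_def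
    by (metis norm_minus_cancel norm_one mult_1)
  then show ?thesis by simp
qed

locale locally_convex =
  fixes scl :: "'k::real_normed_field \<Rightarrow> 'a::ab_group_add \<Rightarrow> 'a" and X :: "'a topology"
  assumes lcs: "locally_convex_space scl X"
begin

sublocale vector_space scl
  using lcs unfolding locally_convex_space_def by (elim conjE)

lemma topspace_UNIV: "topspace X = UNIV"
  using lcs unfolding locally_convex_space_def by (elim conjE)

lemma continuous_add: "continuous_map (prod_topology X X) X (\<lambda>(x, y). x + y)"
  using lcs unfolding locally_convex_space_def by (elim conjE)

lemma continuous_scale: "continuous_map (prod_topology euclidean X) X (\<lambda>(c, x). scl c x)"
  using lcs unfolding locally_convex_space_def by (elim conjE)

lemma continuous_affine: "continuous_map X X (\<lambda>y. scl c (y + a))"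
proof -
  have "continuous_map X (prod_topology X X) (\<lambda>y. (y, a))"
    by (intro continuous_map_pairedI) (auto simp: topspace_UNIV)
  from continuous_map_compose[OF this continuous_add] have "continuous_map X X (\<lambda>y. y + a)"
    by (simp add: o_def)
  then have "continuous_map X (prod_topology euclidean X) (\<lambda>y. (c, y + a))"
    by (intro continuous_map_pairedI) auto
  from continuous_map_compose[OF this continuous_scale] show ?thesis unfolding o_def prod.case .
qed

lemma openin_affine_preimage:
  assumes "openin X U"
  shows "openin X {y. scl c (y + a) \<in> U}"
  using openin_continuous_map_preimage[OF continuous_affine[of c a] assms] by (simp add: topspace_UNIV)

text \<open>
  Boundedness on one neighbourhood of zero is equivalent to continuity for a seminorm, and it
  is the form in which gauges provide it.
\<close>
definition continuous_seminorm :: "('a \<Rightarrow> real) \<Rightarrow> bool" where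
  "continuous_seminorm p \<longleftrightarrow>
     seminorm scl p \<and> (\<exists>N. openin X N \<and> 0 \<in> N \<and> (\<forall>x\<in>N. p x \<le> 1))"

lemma open_absorbing:
  assumes "openin X U" "0 \<in> U"
  shows "\<exists>t>0. scl (of_real t) x \<in> U"
proof -
  have "continuous_map euclidean (prod_topology euclidean X) (\<lambda>c::'k. (c, x))"
    by (intro continuous_map_pairedI) (auto simp: topspace_UNIV)
  from continuous_map_compose[OF this continuous_scale] have "continuous_map euclidean X (\<lambda>c. scl c x)"
    unfolding o_def prod.case .
  from openin_continuous_map_preimage[OF this assms(1)] have "open {c. scl c x \<in> U}" by simp
  moreover have "0 \<in> {c. scl c x \<in> U}" using assms by simp
  ultimately obtain e where "0 < e" and e: "ball 0 e \<subseteq> {c. scl c x \<in> U}"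
    unfolding open_contains_ball by blast
  then have "of_real (e/2) \<in> {c. scl c x \<in> U}" by (intro subsetD[OF e]) auto
  then show ?thesis using \<open>0 < e\<close> by (intro exI[of _ "e/2"]) auto
qed

text \<open>
  Joint continuity of scalar multiplication at \<open>(0, 0)\<close> provides \<open>e > 0\<close> and a neighbourhood \<open>W\<close>
  of zero such that \<open>c w\<close> lies in \<open>V\<close> whenever \<open>norm c < e\<close> and \<open>w \<in> W\<close>. Then \<open>(e/2) W\<close> works.
\<close>
lemma balanced_core_nhd:
  assumes "openin X V" "0 \<in> V"
  obtains N where "openin X N" "0 \<in> N" "\<And>x c. x \<in> N \<Longrightarrow> norm c \<le> 1 \<Longrightarrow> scl c x \<in> V"
proof -
  have "openin (prod_topology euclidean X) {z. (\<lambda>(c, x). scl c x) z \<in> V}"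
    using openin_continuous_map_preimage[OF continuous_scale assms(1)]
    by (simp only: topspace_prod_topology topspace_UNIV topspace_euclidean UNIV_Times_UNIV UNIV_I simp_thms)
  moreover have "(0, 0) \<in> {z. (\<lambda>(c::'k, x). scl c x) z \<in> V}" using assms by simp
  ultimately obtain A W where AW: "openin euclidean A" "openin X W" "0 \<in> A" "0 \<in> W"
      "A \<times> W \<subseteq> {z. (\<lambda>(c, x). scl c x) z \<in> V}"
    unfolding openin_prod_topology_alt by meson
  then obtain e where "0 < e" and e: "ball 0 e \<subseteq> A"
    unfolding open_openin[symmetric] open_contains_ball by blast
  let ?d = "of_real (e/2) :: 'k"
  have d: "norm ?d = e/2" "?d \<noteq> 0" using \<open>0 < e\<close> by (simp_all only: norm_of_real) auto
  let ?N = "{y. scl (1 / ?d) (y + 0) \<in> W}"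
  show thesis
  proof (rule that)
    show "openin X ?N" by (rule openin_affine_preimage[OF AW(2)])
    show "0 \<in> ?N" using AW by simp
    fix x c assume x: "x \<in> ?N" and c: "norm (c::'k) \<le> 1"
    have "norm (c * ?d) = norm c * (e/2)" by (simp only: norm_mult d)
    also have "\<dots> \<le> 1 * (e/2)" using c \<open>0 < e\<close> by (intro mult_right_mono) auto
    finally have "c * ?d \<in> A" using \<open>0 < e\<close> by (intro subsetD[OF e]) simp
    then have "scl (c * ?d) (scl (1 / ?d) x) \<in> V" using AW(5) x by auto
    then show "scl c x \<in> V" using d(2) by (simp add: mult.assoc)
  qed
qed

text \<open>
  The Minkowski functional of an absolutely convex absorbing set.
\<close>
lemma gauge_seminorm:
  assumes conv: "\<And>x y t. x \<in> D \<Longrightarrow> y \<in> D \<Longrightarrow> t \<in> {0..1} \<Longrightarrow>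
        scl (of_real t) x + scl (of_real (1 - t)) y \<in> D"
    and bal: "\<And>x c. x \<in> D \<Longrightarrow> norm c \<le> 1 \<Longrightarrow> scl c x \<in> D"
    and abs: "\<And>x. \<exists>t>0. scl (of_real t) x \<in> D"
  obtains p where "seminorm scl p" "\<And>x. x \<in> D \<Longrightarrow> p x \<le> 1" "\<And>x. p x < 1 \<Longrightarrow> x \<in> D"
proof -
  define S where "S x = {t. 0 < t \<and> scl (of_real (1/t)) x \<in> D}" for x
  define p where "p x = Inf (S x)" for x
  have ne: "S x \<noteq> {}" for x
  proof -
    obtain t where "0 < t" "scl (of_real t) x \<in> D" using abs by blast
    then have "1/t \<in> S x" unfolding S_def by simp
    then show ?thesis by blast
  qed
  have bdd: "bdd_below (S x)" for x by (rule bdd_belowI[of _ 0]) (auto simp: S_def)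
  have le: "p x \<le> t" if "t \<in> S x" for x t unfolding p_def by (intro cInf_lower bdd that)
  have ge: "m \<le> p x" if "\<And>t. t \<in> S x \<Longrightarrow> m \<le> t" for x m
    unfolding p_def by (intro cInf_greatest ne that)
  have nonneg: "0 \<le> p x" for x by (rule ge) (auto simp: S_def)
  have scale_le: "p (scl c x) \<le> norm c * p x" if "c \<noteq> 0" for c x
  proof -
    have "p (scl c x) / norm c \<le> p x"
    proof (rule ge)
      fix t assume t: "t \<in> S x"
      have "norm (c / of_real (norm c)) \<le> 1" using that by (simp add: norm_divide)
      then have "scl (c / of_real (norm c)) (scl (of_real (1/t)) x) \<in> D"
        using t by (intro bal[OF _ \<open>norm (c / of_real (norm c)) \<le> 1\<close>]) (simp add: S_def)
      also have "scl (c / of_real (norm c)) (scl (of_real (1/t)) x) =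
          scl (of_real (1 / (norm c * t))) (scl c x)"
        by (simp add: field_simps)
      finally have "norm c * t \<in> S (scl c x)" using t that by (simp add: S_def)
      from le[OF this] show "p (scl c x) / norm c \<le> t" using that by (simp add: field_simps)
    qed
    then show ?thesis using that by (simp add: field_simps)
  qed
  have zero: "p 0 = 0"
  proof (rule antisym[OF field_le_epsilon nonneg])
    fix e :: real assume "0 < e"
    obtain t where "0 < t" "scl (of_real t) 0 \<in> D" using abs by blast
    then have "e \<in> S 0" using \<open>0 < e\<close> by (simp add: S_def)
    from le[OF this] show "p 0 \<le> 0 + e" by simp
  qed
  have hom: "p (scl c x) = norm c * p x" for c x
  proof (cases "c = 0")
    case True then show ?thesis using zero by simp
  next
    case False
    have "p (scl (1/c) (scl c x)) \<le> norm (1/c) * p (scl c x)"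
      using False by (intro scale_le) simp
    then have "norm c * p x \<le> p (scl c x)"
      using False by (simp add: norm_divide field_simps)
    with scale_le[OF False, of x] show ?thesis by simp
  qed
  have sum: "s + t \<in> S (x + y)" if s: "s \<in> S x" and t: "t \<in> S y" for s t x y
  proof -
    let ?l = "s / (s + t)"
    have pos: "0 < s" "0 < t" using s t by (auto simp: S_def)
    have l: "?l \<in> {0..1}" "1 - ?l = t / (s + t)" using pos by (auto simp: field_simps)
    have "scl (of_real ?l) (scl (of_real (1/s)) x) +
        scl (of_real (1 - ?l)) (scl (of_real (1/t)) y) \<in> D"
      using s t l(1) by (intro conv) (auto simp: S_def)
    also have "scl (of_real ?l) (scl (of_real (1/s)) x) = scl (of_real (1/(s+t))) x"
      unfolding scale_scale of_real_mult[symmetric] using pos by simp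
    also have "scl (of_real (1 - ?l)) (scl (of_real (1/t)) y) = scl (of_real (1/(s+t))) y"
      unfolding l(2) scale_scale of_real_mult[symmetric] using pos by simp
    finally show ?thesis using pos by (simp add: S_def scale_right_distrib)
  qed
  have tri: "p (x + y) \<le> p x + p y" for x y
  proof -
    have "p (x + y) - s \<le> p y" if s: "s \<in> S x" for s
    proof (rule ge)
      fix t assume "t \<in> S y"
      from le[OF sum[OF s this]] show "p (x + y) - s \<le> t" by simp
    qed
    then have "p (x + y) - p y \<le> p x" by (intro ge) (simp add: algebra_simps)
    then show ?thesis by simp
  qed
  show thesis
  proof (rule that)
    show "seminorm scl p" unfolding seminorm_def using nonneg tri hom by blast
    show "p x \<le> 1" if "x \<in> D" for x using that by (intro le) (simp add: S_def)
    fix x assume "p x < 1"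
    then obtain t where t: "t \<in> S x" "t < 1"
      unfolding p_def using cInf_lessD[OF ne] by blast
    then have "scl (of_real t) (scl (of_real (1/t)) x) \<in> D"
      by (intro bal[of "scl (of_real (1/t)) x"]) (simp_all add: S_def)
    then show "x \<in> D"
      using t unfolding scale_scale of_real_mult[symmetric] by (simp add: S_def)
  qed
qed

text \<open>
  The defining neighbourhoods are convex but perhaps not balanced; passing to the largest
  balanced subset \<open>D\<close> of a convex neighbourhood \<open>C\<close> keeps convexity, and \<open>D\<close> is still a
  neighbourhood of zero. The gauge of \<open>D\<close> is the required seminorm.
\<close>
lemma nhd_contains_seminorm_ball:
  assumes U: "openin X U" "0 \<in> U"
  obtains p where "continuous_seminorm p" "\<And>x. p x < 1 \<Longrightarrow> x \<in> U"
proof -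
  obtain V C where V: "openin X V" "0 \<in> V" "V \<subseteq> C" "C \<subseteq> U"
    and C: "\<And>x y t. x \<in> C \<Longrightarrow> y \<in> C \<Longrightarrow> t \<in> {0..1} \<Longrightarrow>
        scl (of_real t) x + scl (of_real (1 - t)) y \<in> C"
    using lcs U unfolding locally_convex_space_def by metis
  obtain N where N: "openin X N" "0 \<in> N"
      "\<And>x c. x \<in> N \<Longrightarrow> norm c \<le> 1 \<Longrightarrow> scl c x \<in> V"
    using balanced_core_nhd[OF V(1,2)] by metis
  define D where "D = {x. \<forall>c. norm c \<le> 1 \<longrightarrow> scl c x \<in> C}"
  have ND: "N \<subseteq> D" using N(3) V(3) unfolding D_def by blast
  have DU: "D \<subseteq> U"
  proof
    fix x assume "x \<in> D"
    then have "scl 1 x \<in> C" unfolding D_def by (metis (mono_tags) mem_Collect_eq norm_one order_refl)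
    then show "x \<in> U" using V(4) by auto
  qed
  obtain p where p: "seminorm scl p" "\<And>x. x \<in> D \<Longrightarrow> p x \<le> 1" "\<And>x. p x < 1 \<Longrightarrow> x \<in> D"
  proof (rule gauge_seminorm[of D])
    fix x y and t :: real assume xy: "x \<in> D" "y \<in> D" and t: "t \<in> {0..1}"
    have "scl c (scl (of_real t) x + scl (of_real (1 - t)) y) \<in> C" if "norm c \<le> 1" for c
    proof -
      have "scl (of_real t) (scl c x) + scl (of_real (1 - t)) (scl c y) \<in> C"
        using xy t that by (intro C) (auto simp: D_def)
      then show ?thesis by (simp only: scale_right_distrib scale_scale mult.commute)
    qed
    then show "scl (of_real t) x + scl (of_real (1 - t)) y \<in> D" unfolding D_def by blast
  next
    fix x and c :: 'k assume "x \<in> D" "norm c \<le> 1"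
    then show "scl c x \<in> D" unfolding D_def by (auto simp: norm_mult mult_le_one)
  next
    fix x
    show "\<exists>t>0. scl (of_real t) x \<in> D" using open_absorbing[OF N(1,2)] ND by blast
  qed (rule that)
  have "continuous_seminorm p"
    unfolding continuous_seminorm_def using p(1,2) N(1,2) ND by (intro conjI exI[of _ N]) auto
  with p(3) DU show thesis by (intro that) auto
qed

lemma seminorm_scaled_ball_nhd:
  assumes "continuous_seminorm p" "0 < e"
  obtains U where "openin X U" "a \<in> U" "\<And>y. y \<in> U \<Longrightarrow> p (y - a) \<le> e"
proof -
  obtain N where N: "openin X N" "0 \<in> N" "\<And>x. x \<in> N \<Longrightarrow> p x \<le> 1" and p: "seminorm scl p"
    using assms unfolding continuous_seminorm_def by blast
  show thesis
  proof (rule that)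
    show "openin X {y. scl (of_real (1/e)) (y + - a) \<in> N}" by (rule openin_affine_preimage[OF N(1)])
    show "a \<in> {y. scl (of_real (1/e)) (y + - a) \<in> N}" using N by simp
    fix y assume "y \<in> {y. scl (of_real (1/e)) (y + - a) \<in> N}"
    then have "p (scl (of_real (1/e)) (y - a)) \<le> 1" using N(3) by simp
    moreover have "p (scl (of_real (1/e)) (y - a)) = norm (of_real (1/e) :: 'k) * p (y - a)"
      using p unfolding seminorm_def by blast
    ultimately have "1/e * p (y - a) \<le> 1" using \<open>0 < e\<close> by (simp only: norm_of_real) simp
    then show "p (y - a) \<le> e" using \<open>0 < e\<close> by (simp add: field_simps)
  qed
qed

lemma continuous_seminorm_bounded_on:
  assumes "continuous_seminorm p" "tvs_bounded scl X B"
  obtains r where "0 < r" "\<And>x. x \<in> B \<Longrightarrow> p x \<le> r"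
proof -
  obtain N where N: "openin X N" "0 \<in> N" "\<And>x. x \<in> N \<Longrightarrow> p x \<le> 1" and p: "seminorm scl p"
    using assms unfolding continuous_seminorm_def by blast
  obtain r where r: "0 < r" "\<And>c. r \<le> norm c \<Longrightarrow> B \<subseteq> scl c ` N"
    using assms N unfolding tvs_bounded_def by meson
  have "B \<subseteq> scl (of_real r) ` N" using r by simp
  moreover have "p (scl (of_real r) x) \<le> r" if "x \<in> N" for x
    using p N(3)[OF that] r(1) unfolding seminorm_def by simp
  ultimately show thesis using r(1) by (intro that) auto
qed

lemma dominated_functional_continuous:
  assumes "Vector_Spaces.linear scl (*) f" "continuous_seminorm p" "\<And>x. norm (f x) \<le> p x"
  shows "f \<in> continuous_dual scl X"
proof -
  interpret f: Vector_Spaces.linear scl "(*)" f by fact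
  have "continuous_map X euclidean f"
    unfolding mtopology_is_euclidean[symmetric] Met_TC.continuous_map_to_metric
  proof (intro ballI allI impI)
    fix x and e :: real assume "0 < e"
    then obtain U where U: "openin X U" "x \<in> U" "\<And>y. y \<in> U \<Longrightarrow> p (y - x) \<le> e/2"
      using seminorm_scaled_ball_nhd[OF assms(2), of "e/2" x] by auto
    have "f y \<in> ball (f x) e" if "y \<in> U" for y
      using assms(3)[of "y - x"] U(3)[OF that] \<open>0 < e\<close>
      by (simp add: f.diff dist_norm norm_minus_commute)
    then show "\<exists>U. openin X U \<and> x \<in> U \<and> (\<forall>y\<in>U. f y \<in> Met_TC.mball (f x) e)"
      using U by auto
  qed
  then show ?thesis unfolding continuous_dual_def using assms by blast
qed

lemma functional_bounded_on:
  assumes f: "f \<in> continuous_dual scl X" and B: "tvs_bounded scl X B"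
  obtains r where "0 < r" "\<And>x. x \<in> B \<Longrightarrow> norm (f x) \<le> r"
proof -
  interpret f: Vector_Spaces.linear scl "(*)" f using f unfolding continuous_dual_def by blast
  have c: "continuous_map X euclidean f" using f unfolding continuous_dual_def by blast
  let ?U = "{x. f x \<in> ball 0 1}"
  have "openin X ?U"
    using openin_continuous_map_preimage[OF c, of "ball 0 1"] by (simp add: topspace_UNIV)
  moreover have "0 \<in> ?U" by (simp add: f.zero)
  ultimately obtain r where r: "0 < r" "\<And>c. r \<le> norm c \<Longrightarrow> B \<subseteq> scl c ` ?U"
    using B unfolding tvs_bounded_def by meson
  have "B \<subseteq> scl (of_real r) ` ?U" using r by simp
  moreover have "norm (f (scl (of_real r) x)) \<le> r" if "x \<in> ?U" for x
    using that r(1) by (simp add: f.scale norm_mult)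
  ultimately show thesis using r(1) by (intro that) auto
qed

section \<open>Bounded neighbourhoods and normability\<close>

text \<open>
  Kolmogorov's criterion. A continuous seminorm \<open>p\<close> whose unit ball lies in \<open>U\<close> has a bounded unit ball,
  so its balls form a neighbourhood basis of zero, and the Hausdorff property makes \<open>p\<close> a norm.
\<close>
lemma normable_if_bounded_nhd:
  assumes U: "openin X U" "0 \<in> U" and bdd: "tvs_bounded scl X U"
  shows "normable scl X"
proof -
  obtain p where p: "continuous_seminorm p" "\<And>x. p x < 1 \<Longrightarrow> x \<in> U"
    using nhd_contains_seminorm_ball[OF U] by metis
  have sn: "seminorm scl p" using p(1) unfolding continuous_seminorm_def by blast
  have nonneg: "0 \<le> p x" and tri: "p (x + y) \<le> p x + p y"
    and hom: "p (scl c x) = norm c * p x" for x y c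
    using sn unfolding seminorm_def by auto
  note p0 = seminorm_zero[OF vector_space_axioms sn]
  have small: "\<exists>r>0. \<forall>x. p x < r \<longrightarrow> x \<in> W" if W: "openin X W" "0 \<in> W" for W
  proof -
    obtain r where r: "0 < r" "\<And>c. r \<le> norm c \<Longrightarrow> U \<subseteq> scl c ` W"
      using bdd W unfolding tvs_bounded_def by meson
    have sub: "U \<subseteq> scl (of_real r) ` W" using r by simp
    have "x \<in> W" if "p x < 1/r" for x
    proof -
      have "p (scl (of_real r) x) < 1" using that r(1) by (simp add: hom field_simps)
      then obtain w where w: "w \<in> W" "scl (of_real r) x = scl (of_real r) w"
        using p(2) sub by blast
      then show ?thesis using r(1) by simp
    qed
    then show ?thesis using r(1) by (intro exI[of _ "1/r"]) auto
  qed
  have eq0: "p x = 0 \<longleftrightarrow> x = 0" for x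
  proof
    assume px: "p x = 0"
    show "x = 0"
    proof (rule ccontr)
      assume "x \<noteq> 0"
      then obtain W W' where "openin X W" "0 \<in> W" "openin X W'" "x \<in> W'" "disjnt W W'"
        using lcs unfolding locally_convex_space_def Hausdorff_space_def by (metis UNIV_I)
      moreover have "x \<in> W" using small[of W] px calculation by auto
      ultimately show False by (auto simp: disjnt_def)
    qed
  qed (simp add: p0)
  let ?d = "\<lambda>x y. p (x - y)"
  interpret M: Metric_space UNIV ?d
  proof
    fix x y z
    show "0 \<le> ?d x y" by (rule nonneg)
    show "?d x y = ?d y x" using seminorm_uminus[OF vector_space_axioms sn, of "x - y"] by simp
    show "?d x y = 0 \<longleftrightarrow> x = y" by (simp add: eq0)
    show "?d x z \<le> ?d x y + ?d y z" using tri[of "x - y" "y - z"] by simp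
  qed
  have "openin X W \<longleftrightarrow> openin M.mtopology W" for W
  proof
    assume W: "openin X W"
    show "openin M.mtopology W"
      unfolding M.openin_mtopology
    proof (intro conjI allI impI)
      fix x assume x: "x \<in> W"
      have "openin X {y. scl 1 (y + x) \<in> W}" by (rule openin_affine_preimage[OF W])
      then obtain r where r: "0 < r" "\<And>y. p y < r \<Longrightarrow> y + x \<in> W"
        using small[of "{y. scl 1 (y + x) \<in> W}"] x by auto
      have "y \<in> W" if "y \<in> M.mball x r" for y
      proof -
        have "p (y - x) < r" using that M.commute by simp
        from r(2)[OF this] show ?thesis by simp
      qed
      then show "\<exists>r>0. M.mball x r \<subseteq> W" using r(1) by blast
    qed simp
  next
    assume W: "openin M.mtopology W"
    show "openin X W"
    proof (subst openin_subopen, intro ballI)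
      fix x assume "x \<in> W"
      then obtain r where r: "0 < r" "M.mball x r \<subseteq> W" using W unfolding M.openin_mtopology by blast
      obtain T where T: "openin X T" "x \<in> T" "\<And>y. y \<in> T \<Longrightarrow> p (y - x) \<le> r/2"
        using seminorm_scaled_ball_nhd[OF p(1), of "r/2" x] r(1) by auto
      have "y \<in> W" if "y \<in> T" for y
      proof (rule subsetD[OF r(2)])
        show "y \<in> M.mball x r" using T(3)[OF that] r(1) M.commute[of x y] by simp
      qed
      then show "\<exists>T. openin X T \<and> x \<in> T \<and> T \<subseteq> W" using T by blast
    qed
  qed
  then have "X = M.mtopology" by (simp add: topology_eq)
  then show ?thesis unfolding normable_def using nonneg eq0 hom tri by blast
qed

end

section \<open>Countable fan tightness of normable spaces\<close>

text \<open>
  In a metric space one point of \<open>A n\<close> at distance less than \<open>1 / (n + 1)\<close> from \<open>x\<close> suffices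
  for each \<open>n\<close>.
\<close>
lemma normable_imp_countable_fan_tightness:
  assumes V: "vector_space scl" and "normable scl X"
  shows "countable_fan_tightness X"
proof -
  interpret vector_space scl by fact
  obtain p where p: "\<And>x. 0 \<le> p x" "\<And>x. p x = 0 \<longleftrightarrow> x = 0"
      "\<And>c x. p (scl c x) = norm c * p x" "\<And>x y. p (x + y) \<le> p x + p y"
    and X: "X = Metric_space.mtopology UNIV (\<lambda>x y. p (x - y))"
    using assms(2) unfolding normable_def by blast
  have sn: "seminorm scl p" using p unfolding seminorm_def by blast
  interpret M: Metric_space UNIV "\<lambda>x y. p (x - y)"
  proof
    fix x y z
    show "p (x - y) = p (y - x)" using seminorm_uminus[OF V sn, of "x - y"] by simp
    show "p (x - z) \<le> p (x - y) + p (y - z)" using p(4)[of "x - y" "y - z"] by simp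
  qed (simp_all add: p)
  show ?thesis
    unfolding countable_fan_tightness_def
  proof (intro ballI allI impI)
    fix x and A :: "nat \<Rightarrow> 'b set"
    assume "(\<forall>n. A n \<subseteq> topspace X) \<and> x \<in> (\<Inter>n. X closure_of A n)"
    then have cl: "x \<in> M.mtopology closure_of A n" for n unfolding X by blast
    have "\<exists>y\<in>A n. p (x - y) < 1 / real (Suc n)" for n
    proof -
      have "0 < 1 / real (Suc n)" by simp
      then show ?thesis using cl[of n] unfolding M.metric_closure_of by (auto simp del: of_nat_Suc)
    qed
    then obtain a where a: "\<And>n. a n \<in> A n" "\<And>n. p (x - a n) < 1 / real (Suc n)" by metis
    have "x \<in> X closure_of (\<Union>n. {a n})"
      unfolding X M.metric_closure_of
    proof (intro CollectI conjI allI impI)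
      fix r :: real assume "0 < r"
      then obtain n where "1 / real (Suc n) < r" using nat_approx_posE by blast
      then have "a n \<in> M.mball x r" using a(2)[of n] by simp
      then show "\<exists>y\<in>\<Union>n. {a n}. y \<in> M.mball x r" by blast
    qed simp
    then show "\<exists>F. (\<forall>n. finite (F n) \<and> F n \<subseteq> A n) \<and> x \<in> X closure_of (\<Union>n. F n)"
      using a(1) by (intro exI[of _ "\<lambda>n. {a n}"]) auto
  qed
qed

section \<open>Countable fan tightness and the (DF) property\<close>

lemma (in locally_convex) equicontinuous_finite:
  assumes "finite H" "H \<subseteq> continuous_dual scl X"
  shows "equicontinuous_set X H"
  unfolding equicontinuous_set_def
proof (intro ballI allI impI)
  fix x and e :: real assume "0 < e"
  have "openin X {y. f y \<in> ball (f x) e}" if "f \<in> H" for f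
  proof -
    have "continuous_map X euclidean f" using assms(2) that unfolding continuous_dual_def by blast
    from openin_continuous_map_preimage[OF this, of "ball (f x) e"]
    show ?thesis by (simp add: topspace_UNIV)
  qed
  then have "openin X (topspace X \<inter> (\<Inter>f\<in>H. {y. f y \<in> ball (f x) e}))"
    using assms(1) by (intro openin_Int_Inter) auto
  then show "\<exists>U. openin X U \<and> x \<in> U \<and> (\<forall>f\<in>H. \<forall>y\<in>U. dist (f y) (f x) < e)"
    using \<open>0 < e\<close> by (intro exI conjI) (auto simp: topspace_UNIV dist_commute)
qed

lemma (in locally_convex) dual_scale_dual:
  assumes "f \<in> continuous_dual scl X"
  shows "dual_scale c f \<in> continuous_dual scl X"
proof -
  interpret f: Vector_Spaces.linear scl "(*)" f using assms unfolding continuous_dual_def by blast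
  have "Vector_Spaces.linear scl (*) (dual_scale c f)"
    unfolding Vector_Spaces.linear_iff dual_scale_def
    using vector_space_axioms vector_space_field by (simp add: f.add f.scale algebra_simps)
  moreover have "continuous_map X euclidean (dual_scale c f)"
  proof -
    have "continuous_map X euclidean f" using assms unfolding continuous_dual_def by blast
    moreover have "continuous_map euclidean euclidean ((*) c)"
      by (simp add: continuous_intros)
    ultimately show ?thesis
      using continuous_map_compose unfolding dual_scale_def o_def by blast
  qed
  ultimately show ?thesis unfolding continuous_dual_def by blast
qed

text \<open>
  A basic strong neighbourhood of zero involves a single bounded set \<open>C \<subseteq> B n\<close> and a radius \<open>e\<close>; if
  \<open>M\<close> is bounded by \<open>k\<close> on \<open>B n\<close>, the factor \<open>k / e\<close> absorbs \<open>M\<close>.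
\<close>
lemma (in locally_convex) strongly_bounded_if_bounded_on:
  assumes B: "\<And>C. tvs_bounded scl X C \<Longrightarrow> \<exists>n. C \<subseteq> B n"
    and M: "M \<subseteq> continuous_dual scl X"
    and K: "\<And>n. \<exists>K>0. \<forall>f\<in>M. \<forall>x\<in>B n. norm (f x) \<le> K"
  shows "tvs_bounded dual_scale (strong_topology scl X) M"
  unfolding tvs_bounded_def topspace_strong_topology
proof (intro conjI allI impI)
  fix U assume "openin (strong_topology scl X) U \<and> 0 \<in> U"
  then obtain C e where C: "tvs_bounded scl X C" "0 < e"
      "{g \<in> continuous_dual scl X. \<forall>x\<in>C. norm (g x) \<le> e} \<subseteq> U"
  proof -
    assume U: "openin (strong_topology scl X) U \<and> 0 \<in> U"
    then obtain C e where "tvs_bounded scl X C" "0 < e"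
        "{g \<in> continuous_dual scl X. \<forall>x\<in>C. norm (g x - 0 x) \<le> e} \<subseteq> U"
      unfolding openin_strong_topology by blast
    then show thesis by (intro that[of C e]) simp_all
  qed
  obtain n where n: "C \<subseteq> B n" using B[OF C(1)] by blast
  obtain k where k: "0 < k" "\<And>f x. f \<in> M \<Longrightarrow> x \<in> B n \<Longrightarrow> norm (f x) \<le> k" using K[of n] by blast
  have "M \<subseteq> dual_scale c ` U" if c: "k / e \<le> norm c" for c
  proof
    fix f assume f: "f \<in> M"
    have "0 < norm c" using c k(1) C(2) by (meson divide_pos_pos less_le_trans)
    let ?g = "dual_scale (1/c) f"
    have "norm (?g x) \<le> e" if "x \<in> C" for x
    proof -
      have "norm (f x) \<le> k" using k(2)[OF f] n that by blast
      also have "\<dots> \<le> e * norm c" using c C(2) by (simp add: field_simps)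
      finally show ?thesis using \<open>0 < norm c\<close> by (simp add: dual_scale_def norm_divide field_simps)
    qed
    then have "?g \<in> U" using C(3) dual_scale_dual f M by blast
    moreover have "f = dual_scale c ?g" using \<open>0 < norm c\<close> by (auto simp: dual_scale_def)
    ultimately show "f \<in> dual_scale c ` U" by blast
  qed
  then show "\<exists>r>0. \<forall>c. r \<le> norm c \<longrightarrow> M \<subseteq> dual_scale c ` U"
    using k(1) C(2) by (intro exI[of _ "k / e"]) auto
qed (rule M)

text \<open>
  The complement of this set is contained in the bipolar of \<open>B\<close>. Working with the polar in place of the closed
  absolutely convex hull of \<open>B\<close> supplies the functionals directly, without separating points
  from closed convex sets.
\<close>
definition polar_detected ::
  "('k::real_normed_field \<Rightarrow> 'a::ab_group_add \<Rightarrow> 'a) \<Rightarrow> 'a topology \<Rightarrow> 'a set \<Rightarrow> 'a set" where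
  "polar_detected scl X B =
     {x. \<exists>f\<in>continuous_dual scl X. (\<forall>b\<in>B. norm (f b) \<le> 1) \<and> 1 \<le> norm (f x)}"

text \<open>
  A continuous seminorm \<open>p\<close> with \<open>p \<le> r\<close> on \<open>B\<close> satisfies \<open>p < r\<close> on \<open>U\<close>: at a point \<open>x\<close> with
  \<open>r \<le> p x\<close>, a functional \<open>f\<close> dominated by \<open>p\<close> and norming \<open>x\<close> yields \<open>f / r\<close>, which is in the
  polar of \<open>B\<close> and detects \<open>x\<close>. So \<open>U\<close> is bounded for every continuous seminorm.
\<close>
lemma (in locally_convex) bounded_if_disjoint_polar_detected:
  assumes HB: "has_norming_functionals scl"
    and B: "tvs_bounded scl X B" and U: "U \<inter> polar_detected scl X B = {}"
  shows "tvs_bounded scl X U"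
  unfolding tvs_bounded_def topspace_UNIV
proof (intro conjI allI impI)
  fix W assume "openin X W \<and> 0 \<in> W"
  then obtain p where p: "continuous_seminorm p" "\<And>x. p x < 1 \<Longrightarrow> x \<in> W"
    using nhd_contains_seminorm_ball[of W] by metis
  obtain r where r: "0 < r" "\<And>x. x \<in> B \<Longrightarrow> p x \<le> r"
    using continuous_seminorm_bounded_on[OF p(1) B] by metis
  have sn: "seminorm scl p" using p(1) unfolding continuous_seminorm_def by blast
  have lt: "p x < r" if x: "x \<in> U" for x
  proof (rule ccontr)
    assume "\<not> p x < r"
    obtain f where f: "Vector_Spaces.linear scl (*) f" "\<And>y. norm (f y) \<le> p y" "norm (f x) = p x"
      using HB sn unfolding has_norming_functionals_def by metis
    let ?g = "dual_scale (1 / of_real r) f"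
    have "?g \<in> continuous_dual scl X"
      using dominated_functional_continuous[OF f(1) p(1) f(2)] by (rule dual_scale_dual)
    moreover have g: "norm (?g y) = norm (f y) / r" for y
      using r(1) by (simp add: dual_scale_def norm_divide)
    moreover have "norm (f b) / r \<le> 1" if "b \<in> B" for b
      using f(2)[of b] r(2)[OF that] r(1) by simp
    moreover have "1 \<le> norm (f x) / r" using \<open>\<not> p x < r\<close> f(3) r(1) by simp
    ultimately have "x \<in> polar_detected scl X B" unfolding polar_detected_def by (auto intro!: bexI[of _ ?g])
    then show False using U x by blast
  qed
  have "U \<subseteq> scl c ` W" if c: "r \<le> norm c" for c
  proof
    fix x assume "x \<in> U"
    have c0: "c \<noteq> 0" using c r(1) by auto
    have "p (scl (1/c) x) = norm (1/c) * p x" using sn unfolding seminorm_def by blast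
    also have "\<dots> < 1" using lt[OF \<open>x \<in> U\<close>] c r(1) c0 by (simp add: norm_divide field_simps)
    finally have "scl (1/c) x \<in> W" by (rule p(2))
    moreover have "x = scl c (scl (1/c) x)" using c0 by simp
    ultimately show "x \<in> scl c ` W" by blast
  qed
  then show "\<exists>r>0. \<forall>c. r \<le> norm c \<longrightarrow> U \<subseteq> scl c ` W" using r(1) by blast
qed simp

lemma DF_space_increasing_fundamental_sequence:
  assumes "DF_space scl X"
  obtains B :: "nat \<Rightarrow> 'a::ab_group_add set"
  where "\<And>n. tvs_bounded scl X (B n)" "\<And>m n. m \<le> n \<Longrightarrow> B m \<subseteq> B n"
    "\<And>C. tvs_bounded scl X C \<Longrightarrow> \<exists>n. C \<subseteq> B n"
proof -
  obtain A :: "nat \<Rightarrow> 'a set" where A: "\<And>n. tvs_bounded scl X (A n)"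
      "\<And>C. tvs_bounded scl X C \<Longrightarrow> \<exists>n. C \<subseteq> A n"
    using assms unfolding DF_space_def has_fundamental_sequence_of_bounded_sets_def by metis
  let ?B = "\<lambda>n. \<Union>i\<le>n. A i"
  have "tvs_bounded scl X (?B n)" for n
    by (induction n) (auto simp: A(1) atMost_Suc intro: tvs_bounded_Un)
  moreover have "?B m \<subseteq> ?B n" if "m \<le> n" for m n using that by (auto intro: le_trans)
  moreover have "\<exists>n. C \<subseteq> ?B n" if "tvs_bounded scl X C" for C using A(2)[OF that] by blast
  ultimately show thesis by (rule that)
qed

text \<open>
  Otherwise fan tightness selects finite sets of detected points whose union accumulates at
  zero. The countably many detecting functionals form a strongly bounded set, because on a
  given \<open>B m\<close> all but finitely many of them are bounded by one. The (DF) property makes this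
  set equicontinuous, so near zero all these functionals have modulus less than one, whereas
  each has modulus at least one at the point that it detects.
\<close>
lemma DF_space_fan_tight_some_not_closure:
  fixes scl :: "'k::real_normed_field \<Rightarrow> 'a::ab_group_add \<Rightarrow> 'a"
  assumes DF: "DF_space scl X" and tight: "countable_fan_tightness X"
    and bdd: "\<And>n::nat. tvs_bounded scl X (B n)" and mono: "\<And>m n. m \<le> n \<Longrightarrow> B m \<subseteq> B n"
    and fund: "\<And>C. tvs_bounded scl X C \<Longrightarrow> \<exists>n. C \<subseteq> B n"
  shows "\<exists>n. 0 \<notin> X closure_of polar_detected scl X (B n)"
proof (rule ccontr)
  interpret locally_convex scl X
    using DF unfolding DF_space_def by unfold_locales (elim conjE)
  let ?A = "\<lambda>n. polar_detected scl X (B n)"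
  assume "\<not> ?thesis"
  then have "0 \<in> (\<Inter>n. X closure_of ?A n)" by blast
  then obtain F where F: "\<And>n. finite (F n)" "\<And>n. F n \<subseteq> ?A n" "0 \<in> X closure_of (\<Union>n. F n)"
    using tight[unfolded countable_fan_tightness_def, rule_format, of 0 ?A]
    by (auto simp: topspace_UNIV)
  let ?P = "\<lambda>n x f. f \<in> continuous_dual scl X \<and> (\<forall>b\<in>B n. norm (f b) \<le> 1) \<and> 1 \<le> norm (f x)"
  define g where "g n x = (SOME f. ?P n x f)" for n x
  have "?P n x (g n x)" if "x \<in> F n" for n x
    unfolding g_def using F(2)[of n] that
    by (intro someI_ex[of "?P n x"]) (auto simp: polar_detected_def)
  then have g: "\<And>n x. x \<in> F n \<Longrightarrow> g n x \<in> continuous_dual scl X"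
      "\<And>n x b. x \<in> F n \<Longrightarrow> b \<in> B n \<Longrightarrow> norm (g n x b) \<le> 1"
      "\<And>n x. x \<in> F n \<Longrightarrow> 1 \<le> norm (g n x x)"
    by blast+
  let ?H = "\<lambda>n. g n ` F n"
  let ?M = "\<Union>n. ?H n"
  have "tvs_bounded dual_scale (strong_topology scl X) ?M"
  proof (rule strongly_bounded_if_bounded_on[OF fund])
    show "?M \<subseteq> continuous_dual scl X" using g(1) by blast
    fix m
    \<comment> \<open>the functionals chosen before stage \<open>m\<close> are finitely many and each is bounded on \<open>B m\<close>;
      the later ones are bounded by one there, since \<open>B m \<subseteq> B n\<close> for \<open>m \<le> n\<close>\<close>
    let ?E = "\<Union>n<m. ?H n"
    have "\<exists>r. \<forall>x\<in>B m. norm (f x) \<le> r" if "f \<in> ?E" for f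
    proof -
      have "f \<in> continuous_dual scl X" using that g(1) by blast
      from functional_bounded_on[OF this bdd] show ?thesis by metis
    qed
    then obtain r where r: "\<And>f x. f \<in> ?E \<Longrightarrow> x \<in> B m \<Longrightarrow> norm (f x) \<le> r f" by metis
    have fin: "finite (insert 1 (r ` ?E))" using F(1) by simp
    let ?K = "Max (insert 1 (r ` ?E))"
    have K1: "1 \<le> ?K" using fin by (intro Max_ge) auto
    have "norm (f x) \<le> ?K" if f: "f \<in> ?M" and x: "x \<in> B m" for f x
    proof (cases "f \<in> ?E")
      case True
      then have "r f \<le> ?K" using fin by (intro Max_ge) auto
      with r[OF True x] show ?thesis by linarith
    next
      case False
      obtain n y where n: "f = g n y" "y \<in> F n" using f by blast
      with False have "m \<le> n" by (force simp: not_less[symmetric])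
      then have "norm (f x) \<le> 1" using g(2)[OF n(2)] mono[of m n] x n(1) by blast
      with K1 show ?thesis by linarith
    qed
    then show "\<exists>K>0. \<forall>f\<in>?M. \<forall>x\<in>B m. norm (f x) \<le> K" using K1
      by (intro exI[of _ ?K]) auto
  qed
  moreover have H: "?H n \<subseteq> continuous_dual scl X \<and> equicontinuous_set X (?H n)" for n
  proof
    show sub: "?H n \<subseteq> continuous_dual scl X" using g(1) by blast
    show "equicontinuous_set X (?H n)" using F(1) by (intro equicontinuous_finite sub) simp
  qed
  ultimately have "equicontinuous_set X ?M"
    by (intro DF[unfolded DF_space_def, THEN conjunct2, THEN conjunct2, rule_format, of ?M]
        conjI exI[of _ ?H] allI H refl)
  from this[unfolded equicontinuous_set_def topspace_UNIV, rule_format, OF UNIV_I[of 0] zero_less_one]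
  obtain U where U: "openin X U" "0 \<in> U" "\<forall>f\<in>?M. \<forall>y\<in>U. dist (f y) (f 0) < 1"
    by (elim exE conjE) (rule that)
  have "\<exists>y. y \<in> (\<Union>n. F n) \<and> y \<in> U"
    using F(3)[unfolded in_closure_of, THEN conjunct2, rule_format, of U] U(1,2) by simp
  then obtain n y where y: "y \<in> F n" "y \<in> U" by blast
  interpret f: Vector_Spaces.linear scl "(*)" "g n y"
    using g(1)[OF y(1)] unfolding continuous_dual_def by blast
  have "dist (g n y y) (g n y 0) < 1" using U(3) y by blast
  then show False using g(3)[OF y(1)] by (simp add: f.zero)
qed

lemma DF_space_normable_iff_countable_fan_tightness:
  assumes HB: "has_norming_functionals scl" and DF: "DF_space scl X"
  shows "normable scl X \<longleftrightarrow> countable_fan_tightness X"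
proof
  interpret locally_convex scl X
    using DF unfolding DF_space_def by unfold_locales (elim conjE)
  show "countable_fan_tightness X" if "normable scl X"
    using normable_imp_countable_fan_tightness[OF vector_space_axioms that] .
  assume tight: "countable_fan_tightness X"
  obtain B :: "nat \<Rightarrow> 'b set"
    where B: "\<And>n. tvs_bounded scl X (B n)" "\<And>m n. m \<le> n \<Longrightarrow> B m \<subseteq> B n"
      "\<And>C. tvs_bounded scl X C \<Longrightarrow> \<exists>n. C \<subseteq> B n"
    using DF_space_increasing_fundamental_sequence[OF DF] by metis
  obtain n where "0 \<notin> X closure_of polar_detected scl X (B n)"
    using DF_space_fan_tight_some_not_closure[OF DF tight, of B] B by blast
  then obtain U where U: "openin X U" "0 \<in> U" "U \<inter> polar_detected scl X (B n) = {}"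
    unfolding in_closure_of topspace_UNIV by blast
  show "normable scl X"
    by (rule normable_if_bounded_nhd[OF U(1,2) bounded_if_disjoint_polar_detected[OF HB B(1) U(3)]])
qed

theorem corollary2p4:
  fixes smult_real :: "real \<Rightarrow> 'a::ab_group_add \<Rightarrow> 'a" and X :: "'a topology"
    and smult_complex :: "complex \<Rightarrow> 'b::ab_group_add \<Rightarrow> 'b" and Y :: "'b topology"
  shows "(DF_space smult_real X \<longrightarrow> (normable smult_real X \<longleftrightarrow> countable_fan_tightness X)) \<and>
         (DF_space smult_complex Y \<longrightarrow> (normable smult_complex Y \<longleftrightarrow> countable_fan_tightness Y))"
proof (intro conjI impI)
  assume DF: "DF_space smult_real X"
  then have "vector_space smult_real" unfolding DF_space_def locally_convex_space_def by (elim conjE)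
  from DF_space_normable_iff_countable_fan_tightness[OF has_norming_functionals_real[OF this] DF]
  show "normable smult_real X \<longleftrightarrow> countable_fan_tightness X" .
next
  assume DF: "DF_space smult_complex Y"
  then have "vector_space smult_complex" unfolding DF_space_def locally_convex_space_def by (elim conjE)
  from DF_space_normable_iff_countable_fan_tightness[OF has_norming_functionals_complex[OF this] DF]
  show "normable smult_complex Y \<longleftrightarrow> countable_fan_tightness Y" .
qed

end
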